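(* Let $\{T(t)\}_{t\ge 0}$ be a $C_0$-semigroup on a complex Banach space $(X,\|\cdot\|)$ with generator $A$. For $\{T(t)\}_{t\ge 0}$ to be uniformly exponentially stable it is necessary and, provided that the spectral bound equal growth bound condition $s(A)=\omega_0$ holds, sufficient that $$\{\lambda\in\mathbb{C} : \operatorname{Re}\lambda\ge 0\}\subseteq\rho(A)\quad\text{and}\quad \sup_{\operatorname{Re}\lambda\ge 0}\|R(\lambda,A)\|<\infty.$$
   Context: The norm of operators is the operator norm. The resolvent set $\rho(A)$ is the set of $\lambda\in\mathbb{C}$ for which $R(\lambda,A):=(A-\lambda I)^{-1}$ exists as a bounded linear operator on $X$, and $\sigma(A)=\mathbb{C}\setminus\rho(A)$ is the spectrum. Spectral bound: $s(A):=\sup\{\operatorname{Re}\lambda : \lambda\in\sigma(A)\}$, with $s(A):=-\infty$ if $\sigma(A)=\emptyset$. Growth bound: $\omega_0:=\inf\{\omega\in\mathbb{R} : \exists\, M=M(\omega)\ge 1 \text{ such that } \|T(t)\|\le Me^{\omega t} \text{ for all } t\ge 0\}$. Uniformly exponentially stable: $\omega_0<0$, or equivalently, there exist $\omega<0$ and $M=M(\omega)\ge 1$ with $\|T(t)\|\le Me^{\omega t}$ for all $t\ge 0$. *)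

theory Defs
  imports "HOL-Analysis.Analysis"
begin

class complex_normed_vector = real_normed_vector +
  fixes scaleC :: "complex \<Rightarrow> 'a \<Rightarrow> 'a"  (infixr \<open>*\<^sub>C\<close> 75)
  assumes scaleC_add_right: "c *\<^sub>C (x + y) = c *\<^sub>C x + c *\<^sub>C y"
    and scaleC_add_left: "(c + d) *\<^sub>C x = c *\<^sub>C x + d *\<^sub>C x"
    and scaleC_scaleC: "c *\<^sub>C d *\<^sub>C x = (c * d) *\<^sub>C x"
    and scaleC_of_real: "complex_of_real r *\<^sub>C x = r *\<^sub>R x"
    and norm_scaleC: "norm (c *\<^sub>C x) = cmod c * norm x"

class complex_banach = complex_normed_vector + complete_space

instantiation complex :: complex_banach
begin

definition scaleC_complex :: "complex \<Rightarrow> complex \<Rightarrow> complex"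
  where "scaleC_complex c x = c * x"

instance
  by standard
    (auto simp: scaleC_complex_def algebra_simps scaleR_conv_of_real norm_mult)

end

definition bounded_clinear ::
    "('a::complex_normed_vector \<Rightarrow> 'b::complex_normed_vector) \<Rightarrow> bool"
  where "bounded_clinear f \<longleftrightarrow>
    bounded_linear f \<and> (\<forall>c x. f (c *\<^sub>C x) = c *\<^sub>C f x)"

text \<open>
  An unbounded operator is given by its domain \<open>D\<close> and a total function \<open>A\<close>;
  the values of \<open>A\<close> outside \<open>D\<close> are irrelevant below.
  The sign convention for the resolvent is that of \<open>(A - \<lambda>I)\<^sup>-\<^sup>1\<close>, where the
  operator to be inverted has domain \<open>D\<close> and must be onto the whole space.
\<close>

definition resolvent ::
    "'a::complex_banach set \<Rightarrow> ('a \<Rightarrow> 'a) \<Rightarrow> complex \<Rightarrow> 'a \<Rightarrow> 'a"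
  where "resolvent D A z = inv_into D (\<lambda>x. A x - z *\<^sub>C x)"

definition resolvent_set ::
    "'a::complex_banach set \<Rightarrow> ('a \<Rightarrow> 'a) \<Rightarrow> complex set"
  where "resolvent_set D A =
    {z. bij_betw (\<lambda>x. A x - z *\<^sub>C x) D UNIV \<and> bounded_clinear (resolvent D A z)}"

definition spectrum :: "'a::complex_banach set \<Rightarrow> ('a \<Rightarrow> 'a) \<Rightarrow> complex set"
  where "spectrum D A = UNIV - resolvent_set D A"

text \<open>The supremum is taken in \<open>ereal\<close>, so it is \<open>-\<infinity>\<close> for empty spectrum.\<close>

definition spectral_bound :: "'a::complex_banach set \<Rightarrow> ('a \<Rightarrow> 'a) \<Rightarrow> ereal"
  where "spectral_bound D A = (SUP z\<in>spectrum D A. ereal (Re z))"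

text \<open>
  A semigroup is a function on all of \<open>real\<close>, of which only the values at
  \<open>t \<ge> 0\<close> are used.
\<close>

definition c0_semigroup :: "(real \<Rightarrow> 'a::complex_banach \<Rightarrow> 'a) \<Rightarrow> bool"
  where "c0_semigroup T \<longleftrightarrow>
    (\<forall>t\<ge>0. bounded_clinear (T t)) \<and>
    (\<forall>x. T 0 x = x) \<and>
    (\<forall>s\<ge>0. \<forall>t\<ge>0. \<forall>x. T (s + t) x = T s (T t x)) \<and>
    (\<forall>x. ((\<lambda>t. T t x) \<longlongrightarrow> x) (at_right 0))"

definition is_generator ::
    "(real \<Rightarrow> 'a::complex_banach \<Rightarrow> 'a) \<Rightarrow> 'a set \<Rightarrow> ('a \<Rightarrow> 'a) \<Rightarrow> bool"
  where "is_generator T D A \<longleftrightarrow>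
    D = {x. \<exists>y. ((\<lambda>t. (T t x - x) /\<^sub>R t) \<longlongrightarrow> y) (at_right 0)} \<and>
    (\<forall>x\<in>D. ((\<lambda>t. (T t x - x) /\<^sub>R t) \<longlongrightarrow> A x) (at_right 0))"

text \<open>
  The infimum is taken in \<open>ereal\<close>, since the growth bound is \<open>-\<infinity>\<close> for,
  e.g., nilpotent semigroups.
\<close>

definition growth_bound :: "(real \<Rightarrow> 'a::complex_banach \<Rightarrow> 'a) \<Rightarrow> ereal"
  where "growth_bound T =
    Inf (ereal ` {w. \<exists>M\<ge>1. \<forall>t\<ge>0. onorm (T t) \<le> M * exp (w * t)})"

definition uniformly_exponentially_stable ::
    "(real \<Rightarrow> 'a::complex_banach \<Rightarrow> 'a) \<Rightarrow> bool"
  where "uniformly_exponentially_stable T \<longleftrightarrow> growth_bound T < 0"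

end

theory Submission
  imports Defs
begin

text \<open>
  Necessity. Suppose \<open>\<parallel>T(t)\<parallel> \<le> M e\<^sup>w\<^sup>t\<close> with \<open>w < 0\<close> and let \<open>Re z \<ge> 0\<close>. The rescaled
  semigroup \<open>S(t) = e\<^sup>-\<^sup>z\<^sup>t T(t)\<close> obeys the same estimate and is generated by
  \<open>B = A - z\<close> (\<open>is_generator_rescaled\<close>). Fix a time \<open>t\<close> with \<open>M e\<^sup>w\<^sup>t = 1/2\<close>; it does
  not depend on \<open>z\<close>. The finite-time integral \<open>V x = \<integral> S(s) x ds\<close> over \<open>[0, t]\<close> maps
  into \<open>D\<close> and satisfies \<open>B V = S(t) - I\<close> on the whole space and \<open>V B = S(t) - I\<close> on \<open>D\<close>
  (\<open>integrated_semigroup\<close>). Since \<open>\<parallel>S(t)\<parallel> \<le> 1/2\<close>, the operator \<open>S(t) - I\<close> is invertible.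
  The first identity then makes \<open>B\<close> surjective, and the second gives
  \<open>\<parallel>x\<parallel> \<le> 2 M t \<parallel>B x\<parallel>\<close> on \<open>D\<close>, a bound uniform in \<open>z\<close>
  (\<open>generator_invertible_if_contraction\<close>). Compared with the Laplace transform formula
  for the resolvent, stopping at time \<open>t\<close> avoids improper integrals.

  Sufficiency. If the resolvent is bounded by \<open>K\<close> on the closed right half plane, then by
  the Neumann series argument (\<open>resolvent_set_perturb\<close>) around the points of the imaginary
  axis the resolvent set contains the strip \<open>-1/K < Re z < 0\<close> as well. So the spectral bound
  is at most \<open>-1/K\<close>, and if it equals the growth bound, the latter is negative.
\<close>

text \<open>The Henstock--Kurzweil integral of orbits needs the class of real Banach spaces.\<close>

instance complex_banach \<subseteq> banach ..

section \<open>Complex scalar multiplication\<close>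

lemma scaleC_scaleR_commute:
  fixes x :: "'a::complex_normed_vector"
  shows "c *\<^sub>C (r *\<^sub>R x) = r *\<^sub>R (c *\<^sub>C x)"
  by (simp only: scaleC_of_real [symmetric] scaleC_scaleC mult.commute)

lemma scaleC_one [simp]: "1 *\<^sub>C x = (x::'a::complex_normed_vector)"
  using scaleC_of_real [of 1 x] by simp

lemma bounded_bilinear_scaleC:
  "bounded_bilinear ((*\<^sub>C) :: complex \<Rightarrow> 'a::complex_normed_vector \<Rightarrow> 'a)"
proof
  fix r :: real and a :: complex and b :: 'a
  show "(r *\<^sub>R a) *\<^sub>C b = r *\<^sub>R (a *\<^sub>C b)"
    by (simp only: scaleR_conv_of_real scaleC_scaleC [symmetric] scaleC_of_real)
  show "\<exists>K. \<forall>a (b::'a). norm (a *\<^sub>C b) \<le> norm a * norm b * K"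
    by (intro exI [of _ 1]) (simp add: norm_scaleC)
qed (simp_all add: scaleC_add_left scaleC_add_right scaleC_scaleR_commute)

lemmas tendsto_scaleC = bounded_bilinear.tendsto [OF bounded_bilinear_scaleC]
lemmas scaleC_diff_right = bounded_bilinear.diff_right [OF bounded_bilinear_scaleC]
lemmas scaleC_diff_left = bounded_bilinear.diff_left [OF bounded_bilinear_scaleC]

section \<open>A criterion for membership in the resolvent set\<close>

definition clinear_on_domain :: "'a::complex_banach set \<Rightarrow> ('a \<Rightarrow> 'a) \<Rightarrow> bool"
  where "clinear_on_domain D A \<longleftrightarrow>
    (\<forall>x\<in>D. \<forall>y\<in>D. x + y \<in> D \<and> A (x + y) = A x + A y) \<and>
    (\<forall>c. \<forall>x\<in>D. c *\<^sub>C x \<in> D \<and> A (c *\<^sub>C x) = c *\<^sub>C A x)"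

lemma clinear_on_domain_shift:
  assumes "clinear_on_domain D A"
  shows "clinear_on_domain D (\<lambda>x. A x - z *\<^sub>C x)"
  using assms unfolding clinear_on_domain_def
  by (auto simp: scaleC_add_right scaleC_diff_right scaleC_scaleC mult.commute)

lemma clinear_on_domain_diff:
  assumes "clinear_on_domain D A" "x \<in> D" "y \<in> D"
  shows "x - y \<in> D" "A (x - y) = A x - A y"
proof -
  have m: "(-1) *\<^sub>C v = - v" for v :: 'a
    using scaleC_of_real [of "-1" v] by simp
  have y: "- y \<in> D" "A (- y) = - A y"
    using assms unfolding clinear_on_domain_def by (metis m)+
  show "x - y \<in> D" "A (x - y) = A x - A y"
    using assms y unfolding clinear_on_domain_def
    by (metis diff_conv_add_uminus)+
qed

text \<open>
  The a priori bound on \<open>D\<close> does double duty: it yields injectivity, and it is the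
  norm bound for the inverse.
\<close>

lemma resolvent_setI:
  fixes A :: "'a::complex_banach \<Rightarrow> 'a"
  assumes lin: "clinear_on_domain D A" and K: "0 \<le> K"
    and surj: "\<And>y. \<exists>x\<in>D. A x - z *\<^sub>C x = y"
    and bound: "\<And>x. x \<in> D \<Longrightarrow> norm x \<le> K * norm (A x - z *\<^sub>C x)"
  shows "z \<in> resolvent_set D A" and "onorm (resolvent D A z) \<le> K"
proof -
  let ?B = "\<lambda>x. A x - z *\<^sub>C x" and ?R = "resolvent D A z"
  note linB = clinear_on_domain_shift [OF lin, of z]
  have inj: "inj_on ?B D"
  proof (rule inj_onI)
    fix x y assume xy: "x \<in> D" "y \<in> D" "?B x = ?B y"
    have "norm (x - y) \<le> K * norm (?B (x - y))"
      using clinear_on_domain_diff (1) [OF linB] xy by (intro bound) auto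
    also have "?B (x - y) = 0"
      using clinear_on_domain_diff (2) [OF linB xy(1,2)] xy(3) by simp
    finally show "x = y" by simp
  qed
  have img: "?B ` D = UNIV" using surj by (auto simp: image_iff) metis
  have RD: "?R y \<in> D" and BR: "?B (?R y) = y" for y
    unfolding resolvent_def using img inv_into_into [of y ?B D] f_inv_into_f [of y ?B D]
    by auto
  have RI: "?R y = x" if "x \<in> D" "?B x = y" for x y
    using inj that BR RD by (metis (mono_tags, lifting) inj_onD)
  have nR: "norm (?R y) \<le> K * norm y" for y
    using bound [OF RD [of y]] BR [of y] by simp
  have add: "?R (x + y) = ?R x + ?R y" for x y
    using linB RD BR unfolding clinear_on_domain_def by (intro RI) metis+
  have scC: "?R (c *\<^sub>C x) = c *\<^sub>C ?R x" for c x
    using linB RD BR unfolding clinear_on_domain_def by (intro RI) metis+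
  have "bounded_linear ?R"
  proof (rule bounded_linear_intro [of _ K])
    show "?R (r *\<^sub>R x) = r *\<^sub>R ?R x" for r x
      using scC [of "complex_of_real r" x] by (simp add: scaleC_of_real)
  qed (use add nR in \<open>auto simp: mult.commute\<close>)
  then show "z \<in> resolvent_set D A"
    using inj img scC by (simp add: resolvent_set_def bij_betw_def bounded_clinear_def)
  show "onorm ?R \<le> K"
    using K nR by (rule onorm_bound)
qed

lemma resolvent_bound:
  assumes z: "z \<in> resolvent_set D A" and x: "x \<in> D"
  shows "norm x \<le> onorm (resolvent D A z) * norm (A x - z *\<^sub>C x)"
proof -
  have bij: "bij_betw (\<lambda>x. A x - z *\<^sub>C x) D UNIV"
    and bl: "bounded_linear (resolvent D A z)"
    using z by (auto simp: resolvent_set_def bounded_clinear_def)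
  have "resolvent D A z (A x - z *\<^sub>C x) = x"
    unfolding resolvent_def using bij x
    by (intro inv_into_f_f [where f = "\<lambda>x. A x - z *\<^sub>C x"]) (auto simp: bij_betw_def)
  then show ?thesis using onorm [OF bl, of "A x - z *\<^sub>C x"] by simp
qed

text \<open>
  Solving \<open>A x - w x = y\<close> amounts to solving \<open>x = R(z,A)(y + (w - z) x)\<close>, whose right-hand
  side is a contraction in \<open>x\<close>. The fixed point theorem thus replaces the Neumann series,
  and no limits of operators are needed.
\<close>

lemma resolvent_set_perturb:
  assumes lin: "clinear_on_domain D A"
    and z: "z \<in> resolvent_set D A"
    and w: "cmod (w - z) * onorm (resolvent D A z) < 1"
  shows "w \<in> resolvent_set D A"
proof (rule resolvent_setI (1) [OF lin])
  let ?R = "resolvent D A z" and ?q = "cmod (w - z) * onorm (resolvent D A z)"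
  have bij: "bij_betw (\<lambda>x. A x - z *\<^sub>C x) D UNIV" and bl: "bounded_linear ?R"
    using z by (auto simp: resolvent_set_def bounded_clinear_def)
  have RD: "?R y \<in> D" and BR: "A (?R y) - z *\<^sub>C ?R y = y" for y
    unfolding resolvent_def using bij inv_into_into [of y "\<lambda>x. A x - z *\<^sub>C x" D]
      f_inv_into_f [of y "\<lambda>x. A x - z *\<^sub>C x" D]
    by (auto simp: bij_betw_def)
  have q0: "0 \<le> ?q" using onorm_pos_le [OF bl] by simp
  show "0 \<le> onorm ?R / (1 - ?q)" using w onorm_pos_le [OF bl] by simp
  show "\<exists>x\<in>D. A x - w *\<^sub>C x = y" for y
  proof -
    have "dist (?R (y + (w - z) *\<^sub>C u)) (?R (y + (w - z) *\<^sub>C v)) \<le> ?q * dist u v" for u v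
    proof -
      have "?R (y + (w - z) *\<^sub>C u) - ?R (y + (w - z) *\<^sub>C v) = ?R ((w - z) *\<^sub>C (u - v))"
        by (simp add: bounded_linear.linear [OF bl] linear_diff [symmetric] scaleC_diff_right)
      then show ?thesis
        using onorm [OF bl, of "(w - z) *\<^sub>C (u - v)"]
        by (simp add: dist_norm norm_scaleC mult_ac)
    qed
    then obtain x where x: "?R (y + (w - z) *\<^sub>C x) = x"
      using banach_fix_type [OF q0 w, of "\<lambda>x. ?R (y + (w - z) *\<^sub>C x)"] by blast
    have "x \<in> D" using RD x by metis
    moreover have "A x - w *\<^sub>C x = y"
      using BR [of "y + (w - z) *\<^sub>C x"] x by (simp add: scaleC_diff_left algebra_simps)
    ultimately show ?thesis by blast
  qed
  show "norm x \<le> onorm ?R / (1 - ?q) * norm (A x - w *\<^sub>C x)" if "x \<in> D" for x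
  proof -
    have "norm x \<le> onorm ?R * norm (A x - z *\<^sub>C x)" by (rule resolvent_bound [OF z that])
    also have "A x - z *\<^sub>C x = (A x - w *\<^sub>C x) + (w - z) *\<^sub>C x"
      by (simp add: scaleC_diff_left)
    also have "onorm ?R * norm \<dots> \<le> onorm ?R * (norm (A x - w *\<^sub>C x) + cmod (w - z) * norm x)"
      using onorm_pos_le [OF bl]
      by (intro mult_left_mono) (auto intro: order_trans [OF norm_triangle_ineq] simp: norm_scaleC)
    finally show ?thesis using w by (simp add: field_simps)
  qed
qed

section \<open>The generator of a semigroup\<close>

text \<open>
  Membership in the domain and the value there are one statement about a limit; with
  this form domain and action of the generator need not be treated separately.
\<close>

lemma generator_iff:
  assumes "is_generator T D A"
  shows "x \<in> D \<and> A x = y \<longleftrightarrow> ((\<lambda>t. (T t x - x) /\<^sub>R t) \<longlongrightarrow> y) (at_right 0)"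
  using assms tendsto_unique [OF trivial_limit_at_right_real]
  unfolding is_generator_def by blast

lemma eventually_at_right_0_nonneg: "eventually (\<lambda>t::real. 0 \<le> t) (at_right 0)"
  by (simp add: eventually_at_right_less eventually_mono [OF eventually_at_right_less])

lemma generator_clinear:
  assumes T: "c0_semigroup T" and gen: "is_generator T D A"
  shows "clinear_on_domain D A"
proof -
  note lim = generator_iff [OF gen, THEN iffD1, OF conjI [OF _ refl]]
  have bc: "bounded_clinear (T t)" if "0 \<le> t" for t
    using T that by (auto simp: c0_semigroup_def)
  have "x + y \<in> D \<and> A (x + y) = A x + A y" if "x \<in> D" "y \<in> D" for x y
    unfolding generator_iff [OF gen]
  proof (rule Lim_transform_eventually [OF tendsto_add [OF lim lim]])
    show "eventually (\<lambda>t. (T t x - x) /\<^sub>R t + (T t y - y) /\<^sub>R t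
        = (T t (x + y) - (x + y)) /\<^sub>R t) (at_right 0)"
      using eventually_at_right_0_nonneg
      by eventually_elim
        (use bc in \<open>auto simp: bounded_clinear_def bounded_linear.linear linear_add algebra_simps\<close>)
  qed (use that in auto)
  moreover have "c *\<^sub>C x \<in> D \<and> A (c *\<^sub>C x) = c *\<^sub>C A x" if "x \<in> D" for c x
    unfolding generator_iff [OF gen]
  proof (rule Lim_transform_eventually [OF tendsto_scaleC [OF tendsto_const lim]])
    show "eventually (\<lambda>t. c *\<^sub>C ((T t x - x) /\<^sub>R t)
        = (T t (c *\<^sub>C x) - c *\<^sub>C x) /\<^sub>R t) (at_right 0)"
      using eventually_at_right_0_nonneg
      by eventually_elim
        (use bc in \<open>auto simp: bounded_clinear_def scaleC_scaleR_commute scaleC_diff_right\<close>)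
  qed (use that in auto)
  ultimately show ?thesis unfolding clinear_on_domain_def by blast
qed

text \<open>
  Passing to the rescaled semigroup turns statements about \<open>A - z\<close> into statements about
  the generator itself, so that only the invertibility of a generator has to be studied.
\<close>

definition rescaled :: "complex \<Rightarrow> (real \<Rightarrow> 'a::complex_banach \<Rightarrow> 'a) \<Rightarrow> real \<Rightarrow> 'a \<Rightarrow> 'a"
  where "rescaled z T t x = exp (- (z * of_real t)) *\<^sub>C T t x"

lemma norm_rescaled: "norm (rescaled z T t x) = exp (- (Re z * t)) * norm (T t x)"
  by (simp add: rescaled_def norm_scaleC)

lemma c0_semigroup_rescaled:
  assumes T: "c0_semigroup T"
  shows "c0_semigroup (rescaled z T)"
  unfolding c0_semigroup_def
proof (intro conjI allI impI)
  have bc: "bounded_clinear (T t)" if "0 \<le> t" for t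
    using T that by (auto simp: c0_semigroup_def)
  show "bounded_clinear (rescaled z T t)" if "0 \<le> t" for t
    unfolding bounded_clinear_def rescaled_def
    using bc [OF that]
    by (auto simp: bounded_clinear_def scaleC_scaleC mult.commute
        intro: bounded_linear_compose
          [OF bounded_bilinear.bounded_linear_right [OF bounded_bilinear_scaleC]])
  show "rescaled z T 0 x = x" for x
    using T by (simp add: rescaled_def c0_semigroup_def)
  show "rescaled z T (s + t) x = rescaled z T s (rescaled z T t x)"
    if "0 \<le> s" "0 \<le> t" for s t x
    using T bc [OF that(1)] that
    by (simp add: rescaled_def c0_semigroup_def bounded_clinear_def scaleC_scaleC
        exp_add [symmetric] algebra_simps)
  have "((\<lambda>t. exp (- (z * of_real t))) \<longlongrightarrow> exp (- (z * of_real 0))) (at_right 0)"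
    by (intro tendsto_intros)
  then show "((\<lambda>t. rescaled z T t x) \<longlongrightarrow> x) (at_right 0)" for x
    unfolding rescaled_def
    using T tendsto_scaleC [of "\<lambda>t. exp (- (z * of_real t))" 1 "at_right 0" "\<lambda>t. T t x" x]
    by (simp add: c0_semigroup_def)
qed

lemma is_generator_rescaled:
  assumes T: "c0_semigroup T" and gen: "is_generator T D A"
  shows "is_generator (rescaled z T) D (\<lambda>x. A x - z *\<^sub>C x)"
proof -
  have e1: "((\<lambda>t. exp (c * of_real t)) \<longlongrightarrow> 1) (at_right (0::real))" for c :: complex
  proof -
    have "((\<lambda>t. exp (c * of_real t)) \<longlongrightarrow> exp (c * of_real 0)) (at_right (0::real))"
      by (intro tendsto_intros)
    then show ?thesis by simp
  qed
  have quot: "((\<lambda>t. (exp (- (z * of_real t)) - 1) /\<^sub>R t) \<longlongrightarrow> - z) (at_right 0)"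
  proof -
    have "((\<lambda>w. exp (- (z * w))) has_field_derivative - z) (at 0)"
      by (auto intro!: derivative_eq_intros)
    then have "((\<lambda>w. (exp (- (z * w)) - 1) / w) \<longlongrightarrow> - z) (at 0)"
      by (simp add: has_field_derivative_iff)
    moreover have "filterlim complex_of_real (at 0) (at_right 0)"
      by (rule filterlim_atI)
        (auto intro!: tendsto_eq_intros simp: eventually_at_right_less eventually_at_filter)
    ultimately have "((\<lambda>t. (exp (- (z * of_real t)) - 1) / of_real t) \<longlongrightarrow> - z) (at_right 0)"
      by (rule filterlim_compose)
    then show ?thesis by (simp add: scaleR_conv_of_real divide_inverse mult.commute)
  qed
  \<comment> \<open>The product rule for difference quotients.\<close>
  have split: "(rescaled z T t x - x) /\<^sub>R t
      = exp (- (z * of_real t)) *\<^sub>C ((T t x - x) /\<^sub>R t)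
        + ((exp (- (z * of_real t)) - 1) /\<^sub>R t) *\<^sub>C x" for t x
    by (simp add: rescaled_def bounded_bilinear.scaleR_left [OF bounded_bilinear_scaleC]
        scaleC_scaleR_commute scaleC_diff_left scaleC_diff_right algebra_simps)
  have iff: "((\<lambda>t. (T t x - x) /\<^sub>R t) \<longlongrightarrow> y) (at_right 0)
      \<longleftrightarrow> ((\<lambda>t. (rescaled z T t x - x) /\<^sub>R t) \<longlongrightarrow> y - z *\<^sub>C x) (at_right 0)" for x y
  proof
    assume "((\<lambda>t. (T t x - x) /\<^sub>R t) \<longlongrightarrow> y) (at_right 0)"
    from tendsto_add [OF tendsto_scaleC [OF e1 [of "-z"] this] tendsto_scaleC [OF quot tendsto_const [of x]]]
    show "((\<lambda>t. (rescaled z T t x - x) /\<^sub>R t) \<longlongrightarrow> y - z *\<^sub>C x) (at_right 0)"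
      unfolding split
      by (simp add: bounded_bilinear.minus_left [OF bounded_bilinear_scaleC])
  next
    assume "((\<lambda>t. (rescaled z T t x - x) /\<^sub>R t) \<longlongrightarrow> y - z *\<^sub>C x) (at_right 0)"
    from tendsto_scaleC [OF e1 [of z] tendsto_diff [OF this tendsto_scaleC [OF quot tendsto_const [of x]]]]
    show "((\<lambda>t. (T t x - x) /\<^sub>R t) \<longlongrightarrow> y) (at_right 0)"
      unfolding split
      by (simp add: bounded_bilinear.minus_left [OF bounded_bilinear_scaleC] scaleC_scaleC
          exp_add [symmetric])
  qed
  have ex: "(\<exists>y. ((\<lambda>t. (T t x - x) /\<^sub>R t) \<longlongrightarrow> y) (at_right 0)) \<longleftrightarrow>
     (\<exists>y. ((\<lambda>t. (rescaled z T t x - x) /\<^sub>R t) \<longlongrightarrow> y) (at_right 0))" for x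
  proof
    show "\<exists>y. ((\<lambda>t. (rescaled z T t x - x) /\<^sub>R t) \<longlongrightarrow> y) (at_right 0)"
      if "\<exists>y. ((\<lambda>t. (T t x - x) /\<^sub>R t) \<longlongrightarrow> y) (at_right 0)"
      using that iff by blast
  next
    assume "\<exists>y. ((\<lambda>t. (rescaled z T t x - x) /\<^sub>R t) \<longlongrightarrow> y) (at_right 0)"
    then obtain y where "((\<lambda>t. (rescaled z T t x - x) /\<^sub>R t) \<longlongrightarrow> y) (at_right 0)" ..
    with iff [of x "y + z *\<^sub>C x"]
    show "\<exists>y. ((\<lambda>t. (T t x - x) /\<^sub>R t) \<longlongrightarrow> y) (at_right 0)" by auto
  qed
  show ?thesis
    using gen iff ex unfolding is_generator_def by auto
qed

section \<open>Integrated semigroups\<close>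

lemma integral_mean_tendsto:
  fixes f :: "real \<Rightarrow> 'a::banach"
  assumes cont: "continuous_on {a..} f"
  shows "((\<lambda>h. integral {a..a+h} f /\<^sub>R h) \<longlongrightarrow> f a) (at_right 0)"
proof (rule tendstoI)
  fix e :: real assume e: "0 < e"
  obtain d where d: "d > 0" "\<And>s. s \<in> {a..} \<Longrightarrow> dist s a < d \<Longrightarrow> dist (f s) (f a) < e/2"
    using cont e unfolding continuous_on_iff by (metis atLeast_iff half_gt_zero order_refl)
  have "dist (integral {a..a+h} f /\<^sub>R h) (f a) < e" if h: "0 < h" "h < d" for h
  proof -
    have c: "continuous_on {a..a+h} f" by (rule continuous_on_subset [OF cont]) auto
    have "integral {a..a+h} (\<lambda>s. f s - f a) = integral {a..a+h} f - h *\<^sub>R f a"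
      using integral_diff [OF integrable_continuous_real [OF c] integrable_const_ivl [of "f a" a "a+h"]] h
      by simp
    moreover have "norm (integral {a..a+h} (\<lambda>s. f s - f a)) \<le> e/2 * (a + h - a)"
      using h d c
      by (intro integral_bound continuous_intros) (auto simp: dist_norm intro!: less_imp_le)
    ultimately have "norm (integral {a..a+h} f - h *\<^sub>R f a) \<le> e/2 * h" by simp
    moreover have "integral {a..a+h} f /\<^sub>R h - f a = (integral {a..a+h} f - h *\<^sub>R f a) /\<^sub>R h"
      using h by (simp add: scaleR_diff_right)
    ultimately have "norm (integral {a..a+h} f /\<^sub>R h - f a) \<le> inverse h * (e/2 * h)"
      using h by simp
    also have "\<dots> = e/2" using h by simp
    finally have "norm (integral {a..a+h} f /\<^sub>R h - f a) \<le> e/2" .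
    then show ?thesis using e by (simp add: dist_norm)
  qed
  then show "eventually (\<lambda>h. dist (integral {a..a+h} f /\<^sub>R h) (f a) < e) (at_right 0)"
    using d(1) by (auto simp: eventually_at_right_field)
qed

text \<open>
  Strong continuity is only assumed at \<open>0\<close>. The uniform bound \<open>M\<close> transports it to every
  time, from both sides, because \<open>S(t) x - S(s) x = S(s) (S(t - s) x - x)\<close> for \<open>s \<le> t\<close>.
\<close>

lemma orbit_continuous:
  assumes S: "c0_semigroup S"
    and M: "\<And>t x. 0 \<le> t \<Longrightarrow> norm (S t x) \<le> M * norm x"
  shows "continuous_on {0..} (\<lambda>t. S t x)"
proof -
  have "\<exists>d>0. \<forall>t\<ge>0. \<forall>s\<ge>0. \<bar>t - s\<bar> < d \<longrightarrow> norm (S t x - S s x) < e" if e: "0 < e" for e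
  proof -
    have "((\<lambda>t. S t x) \<longlongrightarrow> x) (at_right 0)" using S by (simp add: c0_semigroup_def)
    \<comment> \<open>\<open>\<bar>M\<bar> + 1\<close> stands in for \<open>M\<close> as a divisor known to be positive.\<close>
    from tendstoD [OF this, of "e / (\<bar>M\<bar> + 1)"] e
    obtain d where d: "d > 0" "\<And>h. 0 < h \<Longrightarrow> h < d \<Longrightarrow> norm (S h x - x) < e / (\<bar>M\<bar> + 1)"
      by (auto simp: eventually_at_right_field dist_norm)
    have key: "norm (S t x - S s x) < e" if "0 \<le> s" "s < t" "t - s < d" for s t
    proof -
      have "S t x - S s x = S s (S (t - s) x - x)"
      proof -
        have "S t x = S s (S (t - s) x)"
          using S that unfolding c0_semigroup_def
          by (metis add.commute diff_add_cancel diff_ge_0_iff_ge less_imp_le)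
        moreover have "linear (S s)"
          using S that by (auto simp: c0_semigroup_def bounded_clinear_def bounded_linear.linear)
        ultimately show ?thesis by (simp add: linear_diff)
      qed
      then have "norm (S t x - S s x) \<le> M * norm (S (t - s) x - x)" using M that by simp
      also have "\<dots> \<le> (\<bar>M\<bar> + 1) * norm (S (t - s) x - x)" by (intro mult_right_mono) auto
      also have "\<dots> < e" using d(2) [of "t - s"] that by (simp add: field_simps)
      finally show ?thesis .
    qed
    show ?thesis
    proof (intro exI [of _ d] conjI allI impI)
      fix t s :: real assume "0 \<le> t" "0 \<le> s" "\<bar>t - s\<bar> < d"
      then show "norm (S t x - S s x) < e"
        using key [of s t] key [of t s] e by (cases s t rule: linorder_cases) (auto simp: norm_minus_commute)
    qed (fact d)
  qed
  then show ?thesis unfolding continuous_on_iff by (force simp: dist_norm)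
qed

text \<open>
  Applying \<open>S(h)\<close> to \<open>V x\<close> shifts the interval of integration by \<open>h\<close>, so \<open>S(h) V x - V x\<close>
  is an integral over \<open>[t, t + h]\<close> minus one over \<open>[0, h]\<close>. Dividing by \<open>h\<close> gives
  \<open>B V x = S(t) x - x\<close>. The same quotient equals \<open>V\<close> applied to the difference quotient
  of the orbit of \<open>x\<close>, which for \<open>x \<in> D\<close> tends to \<open>V (B x)\<close>; no derivative of the orbit at
  positive times is involved.
\<close>

lemma integrated_semigroup:
  fixes S :: "real \<Rightarrow> 'a::complex_banach \<Rightarrow> 'a"
  assumes S: "c0_semigroup S" and gen: "is_generator S D B"
    and M: "\<And>t x. 0 \<le> t \<Longrightarrow> norm (S t x) \<le> M * norm x"
    and t: "0 \<le> t"
  defines "V \<equiv> \<lambda>x. integral {0..t} (\<lambda>s. S s x)"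
  shows "bounded_linear V" "norm (V x) \<le> M * t * norm x"
    "V x \<in> D" "B (V x) = S t x - x" "x \<in> D \<Longrightarrow> V (B x) = S t x - x"
proof -
  have bl: "bounded_linear (S s)" if "0 \<le> s" for s
    using S that by (auto simp: c0_semigroup_def bounded_clinear_def)
  note lin = bounded_linear.linear [OF bl]
  have cont: "continuous_on {0..} (\<lambda>s. S s x)" for x
    by (rule orbit_continuous [OF S M])
  have int: "(\<lambda>s. S s x) integrable_on {a..b}" if "0 \<le> a" for a b x
    by (rule integrable_continuous_real, rule continuous_on_subset [OF cont]) (use that in auto)
  have V_bound: "norm (V x) \<le> M * t * norm x" for x
    using integral_bound [OF t continuous_on_subset [OF cont], of x "M * norm x"] M
    by (auto simp: V_def mult_ac)
  show V_lin: "bounded_linear V"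
  proof (rule bounded_linear_intro)
    show "V (x + y) = V x + V y" for x y
      unfolding V_def
      by (subst integral_add [symmetric])
        (auto simp: int lin linear_add intro!: integral_cong)
    show "V (r *\<^sub>R x) = r *\<^sub>R V x" for r x
      unfolding V_def
      unfolding integral_cmul [symmetric]
      by (intro integral_cong) (simp add: lin linear_cmul)
    show "norm (V x) \<le> norm x * (M * t)" for x using V_bound [of x] by (simp add: mult_ac)
  qed
  show "norm (V x) \<le> M * t * norm x" by (rule V_bound)
  have SS: "S s (S h x) = S (h + s) x" if "0 \<le> s" "0 \<le> h" for s h x
    using S that unfolding c0_semigroup_def by (metis add.commute)
  have V_commute: "S h (V x) = V (S h x)" if h: "0 \<le> h" for h x
  proof -
    have "S h (V x) = integral {0..t} (S h \<circ> (\<lambda>s. S s x))"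
      unfolding V_def by (rule integral_linear [symmetric, OF int bl]) (use h in auto)
    also have "\<dots> = V (S h x)"
      unfolding V_def using h by (intro integral_cong) (simp add: SS add.commute)
    finally show ?thesis .
  qed
  have V_shift: "V (S h x) - V x = integral {t..t+h} (\<lambda>s. S s x) - integral {0..0+h} (\<lambda>s. S s x)"
    if h: "0 \<le> h" for h x
  proof -
    have "V (S h x) = integral {0..t} ((\<lambda>s. S s x) \<circ> (+) h)"
      unfolding V_def using h by (intro integral_cong) (simp add: SS)
    also have "\<dots> = integral {h..t+h} (\<lambda>s. S s x)"
      by (subst integral_shift_Icc_real) simp
    finally have "V (S h x) = integral {h..t+h} (\<lambda>s. S s x)" .
    moreover have "integral {0..h} (\<lambda>s. S s x) + integral {h..t+h} (\<lambda>s. S s x)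
        = integral {0..t+h} (\<lambda>s. S s x)"
      using h t by (intro Henstock_Kurzweil_Integration.integral_combine int) auto
    moreover have "V x + integral {t..t+h} (\<lambda>s. S s x) = integral {0..t+h} (\<lambda>s. S s x)"
      unfolding V_def using h t by (intro Henstock_Kurzweil_Integration.integral_combine int) auto
    ultimately show ?thesis by (simp add: algebra_simps)
  qed
  have lim: "((\<lambda>h. (S h (V x) - V x) /\<^sub>R h) \<longlongrightarrow> S t x - x) (at_right 0)" for x
  proof (rule Lim_transform_eventually)
    have "((\<lambda>h. integral {t..t+h} (\<lambda>s. S s x) /\<^sub>R h) \<longlongrightarrow> S t x) (at_right 0)"
      by (rule integral_mean_tendsto, rule continuous_on_subset [OF cont]) (use t in auto)
    moreover have "((\<lambda>h. integral {0..0+h} (\<lambda>s. S s x) /\<^sub>R h) \<longlongrightarrow> x) (at_right 0)"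
      using integral_mean_tendsto [OF cont] S by (simp add: c0_semigroup_def)
    ultimately show "((\<lambda>h. integral {t..t+h} (\<lambda>s. S s x) /\<^sub>R h
        - integral {0..0+h} (\<lambda>s. S s x) /\<^sub>R h) \<longlongrightarrow> S t x - x) (at_right 0)"
      by (rule tendsto_diff)
    show "eventually (\<lambda>h. integral {t..t+h} (\<lambda>s. S s x) /\<^sub>R h
        - integral {0..0+h} (\<lambda>s. S s x) /\<^sub>R h = (S h (V x) - V x) /\<^sub>R h) (at_right 0)"
      using eventually_at_right_0_nonneg
      by eventually_elim (simp only: V_commute V_shift scaleR_diff_right)
  qed
  show "V x \<in> D" "B (V x) = S t x - x" using generator_iff [OF gen, THEN iffD2, OF lim] by auto
  show "V (B x) = S t x - x" if "x \<in> D"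
  proof (rule tendsto_unique [OF trivial_limit_at_right_real _ lim])
    show "((\<lambda>h. (S h (V x) - V x) /\<^sub>R h) \<longlongrightarrow> V (B x)) (at_right 0)"
    proof (rule Lim_transform_eventually)
      show "((\<lambda>h. V ((S h x - x) /\<^sub>R h)) \<longlongrightarrow> V (B x)) (at_right 0)"
        using generator_iff [OF gen] that by (intro bounded_linear.tendsto [OF V_lin]) auto
      show "eventually (\<lambda>h. V ((S h x - x) /\<^sub>R h) = (S h (V x) - V x) /\<^sub>R h) (at_right 0)"
        using eventually_at_right_0_nonneg
        by eventually_elim
          (simp add: V_commute linear_diff linear_cmul bounded_linear.linear [OF V_lin])
    qed
  qed
qed

text \<open>
  Since \<open>B V = S(t) - I = V B\<close>, the inverse of \<open>B\<close> is \<open>V (S(t) - I)\<^sup>-\<^sup>1\<close>; the inverse of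
  \<open>S(t) - I\<close> enters through a fixed point \<open>u = S(t) u - y\<close>, which makes \<open>V u\<close> a preimage of \<open>y\<close>.
\<close>

lemma generator_invertible_if_contraction:
  fixes S :: "real \<Rightarrow> 'a::complex_banach \<Rightarrow> 'a"
  assumes S: "c0_semigroup S" and gen: "is_generator S D B"
    and M: "\<And>t x. 0 \<le> t \<Longrightarrow> norm (S t x) \<le> M * norm x"
    and t: "0 \<le> t" and half: "\<And>x. norm (S t x) \<le> norm x / 2"
  shows "\<exists>x\<in>D. B x = y" and "x \<in> D \<Longrightarrow> norm x \<le> 2 * M * t * norm (B x)"
proof -
  let ?V = "\<lambda>x. integral {0..t} (\<lambda>s. S s x)"
  note V = integrated_semigroup [OF S gen M t]
  have lin: "linear (S t)"
    using S t by (auto simp: c0_semigroup_def bounded_clinear_def bounded_linear.linear)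
  have "\<exists>!u. S t u - y = u"
  proof (rule banach_fix_type [of "1/2"])
    show "\<forall>u v. dist (S t u - y) (S t v - y) \<le> 1/2 * dist u v"
      using half by (auto simp: dist_norm linear_diff [OF lin, symmetric])
  qed auto
  then obtain u where "S t u - y = u" by blast
  then have "S t u - u = y" by (simp add: algebra_simps)
  then show "\<exists>x\<in>D. B x = y" using V(3,4) by metis
  assume x: "x \<in> D"
  have "norm x \<le> norm (S t x) + norm (S t x - x)"
    using norm_triangle_ineq4 [of "S t x" "S t x - x"] by simp
  also have "norm (S t x - x) \<le> M * t * norm (B x)" using V(2,5) x by metis
  finally show "norm x \<le> 2 * M * t * norm (B x)" using half [of x] by simp
qed

section \<open>The stability theorem\<close>

lemma stable_imp_resolvent_bounded:
  assumes T: "c0_semigroup T" and gen: "is_generator T D A"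
    and stable: "uniformly_exponentially_stable T"
  obtains K where "\<And>z. 0 \<le> Re z \<Longrightarrow> z \<in> resolvent_set D A \<and> onorm (resolvent D A z) \<le> K"
proof -
  obtain w M where w: "w < 0" and M1: "1 \<le> M"
    and on: "\<And>t. 0 \<le> t \<Longrightarrow> onorm (T t) \<le> M * exp (w * t)"
    using stable unfolding uniformly_exponentially_stable_def growth_bound_def
    by (auto simp: Inf_less_iff)
  have nT: "norm (T t x) \<le> M * exp (w * t) * norm x" if "0 \<le> t" for t x
  proof -
    have "bounded_linear (T t)" using T that by (auto simp: c0_semigroup_def bounded_clinear_def)
    then show ?thesis
      using order_trans [OF onorm mult_right_mono [OF on [OF that] norm_ge_zero]] by blast
  qed
  \<comment> \<open>The time at which the growth estimate has decayed to \<open>1/2\<close>, the same for all \<open>z\<close>.\<close>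
  define t where "t = ln (2 * M) / (- w)"
  have t: "0 \<le> t" using M1 w by (simp add: t_def divide_nonneg_neg)
  have half: "M * exp (w * t) = 1/2"
    using M1 w by (simp add: t_def exp_minus)
  have "z \<in> resolvent_set D A \<and> onorm (resolvent D A z) \<le> 2 * M * t" if z: "0 \<le> Re z" for z
  proof -
    have le: "norm (rescaled z T s x) \<le> norm (T s x)" if "0 \<le> s" for s x
      using z that by (simp add: norm_rescaled mult_left_le_one_le)
    have b1: "norm (rescaled z T s x) \<le> M * norm x" if s: "0 \<le> s" for s x
    proof -
      have "M * exp (w * s) \<le> M" using M1 w s by (simp add: mult_nonpos_nonneg)
      then show ?thesis
        using le [OF s, of x] nT [OF s, of x] mult_right_mono [of "M * exp (w * s)" M "norm x"]
        by auto
    qed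
    have b2: "norm (rescaled z T t x) \<le> norm x / 2" for x
      using le [OF t, of x] nT [OF t, of x] half by simp
    note inv = generator_invertible_if_contraction
      [OF c0_semigroup_rescaled [OF T] is_generator_rescaled [OF T gen] b1 t b2]
    show ?thesis
      using resolvent_setI [OF generator_clinear [OF T gen] _ inv] M1 t by simp
  qed
  then show thesis by (rule that)
qed

lemma resolvent_bounded_imp_spectral_bound_neg:
  assumes lin: "clinear_on_domain D A"
    and sub: "{z. Re z \<ge> 0} \<subseteq> resolvent_set D A"
    and bound: "\<And>z. 0 \<le> Re z \<Longrightarrow> onorm (resolvent D A z) \<le> K" and K: "0 < K"
  shows "spectral_bound D A \<le> ereal (- 1 / K)"
  unfolding spectral_bound_def
proof (rule SUP_least)
  fix z assume z: "z \<in> spectrum D A"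
  have "Re z \<le> - 1 / K"
  proof (rule ccontr)
    assume big: "\<not> Re z \<le> - 1 / K"
    have neg: "Re z < 0"
    proof (rule ccontr)
      assume "\<not> Re z < 0"
      then have "z \<in> {z. Re z \<ge> 0}" by simp
      then show False using z sub unfolding spectrum_def by blast
    qed
    \<comment> \<open>The nearest point of the closed right half plane, at distance \<open>- Re z < 1 / K\<close>.\<close>
    let ?v = "Complex 0 (Im z)"
    have "cmod (z - ?v) = - Re z" using neg by (simp add: cmod_def)
    then have "cmod (z - ?v) * onorm (resolvent D A ?v) \<le> - Re z * K"
      using neg bound [of ?v] by (simp add: mult_left_mono_neg)
    also have "\<dots> < 1" using big K by (simp add: field_simps)
    finally have close: "cmod (z - ?v) * onorm (resolvent D A ?v) < 1" .
    have "?v \<in> resolvent_set D A" using sub by auto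
    then have "z \<in> resolvent_set D A" using close by (rule resolvent_set_perturb [OF lin])
    then show False using z by (simp add: spectrum_def)
  qed
  then show "ereal (Re z) \<le> ereal (- 1 / K)" by simp
qed

theorem theorem5p1:
  fixes T :: "real \<Rightarrow> 'a::complex_banach \<Rightarrow> 'a"
    and D :: "'a set" and A :: "'a \<Rightarrow> 'a"
  assumes "c0_semigroup T"
    and "is_generator T D A"
  shows
    "(uniformly_exponentially_stable T \<longrightarrow>
        {z. Re z \<ge> 0} \<subseteq> resolvent_set D A \<and>
        (SUP z\<in>{z. Re z \<ge> 0}. ereal (onorm (resolvent D A z))) < \<infinity>) \<and>
     (spectral_bound D A = growth_bound T \<longrightarrow>
        {z. Re z \<ge> 0} \<subseteq> resolvent_set D A \<and>
        (SUP z\<in>{z. Re z \<ge> 0}. ereal (onorm (resolvent D A z))) < \<infinity> \<longrightarrow>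
        uniformly_exponentially_stable T)"
proof (intro conjI impI)
  assume "uniformly_exponentially_stable T"
  then obtain K where K: "\<And>z. 0 \<le> Re z \<Longrightarrow> z \<in> resolvent_set D A \<and> onorm (resolvent D A z) \<le> K"
    using stable_imp_resolvent_bounded assms by metis
  show "{z. Re z \<ge> 0} \<subseteq> resolvent_set D A" using K by auto
  have "(SUP z\<in>{z. Re z \<ge> 0}. ereal (onorm (resolvent D A z))) \<le> ereal K"
    using K by (intro SUP_least) auto
  then show "(SUP z\<in>{z. Re z \<ge> 0}. ereal (onorm (resolvent D A z))) < \<infinity>"
    using le_less_trans by fastforce
next
  assume eq: "spectral_bound D A = growth_bound T"
    and *: "{z. Re z \<ge> 0} \<subseteq> resolvent_set D A \<and>
        (SUP z\<in>{z. Re z \<ge> 0}. ereal (onorm (resolvent D A z))) < \<infinity>"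
  then obtain n :: nat where n: "(SUP z\<in>{z. Re z \<ge> 0}. ereal (onorm (resolvent D A z))) < ereal (real n)"
    by (auto simp: less_PInf_Ex_of_nat)
  \<comment> \<open>A strictly positive bound, as the width of the strip is its reciprocal.\<close>
  have "onorm (resolvent D A z) \<le> real n + 1" if "0 \<le> Re z" for z
  proof -
    have "ereal (onorm (resolvent D A z)) \<le> ereal (real n)"
      using that by (intro order_trans [OF SUP_upper less_imp_le [OF n]]) auto
    then show ?thesis by simp
  qed
  then have "spectral_bound D A \<le> ereal (- 1 / (real n + 1))"
    using * by (intro resolvent_bounded_imp_spectral_bound_neg generator_clinear [OF assms]) auto
  also have "\<dots> < 0" by simp
  finally show "uniformly_exponentially_stable T"
    by (simp add: eq uniformly_exponentially_stable_def)
qed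

end
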